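(* Let $k\ge 3$ and let $c_1\ge c_2\ge\dots\ge c_k>0$ be constants with $\sum_{i=1}^k c_i=1$. For every $n$ such that all $c_i n$ are integers, let $G_n$ be the complete $k$-partite graph with parts $V_1,\dots,V_k$, $|V_i|=c_i n$. Then, as $n\to\infty$ along such values: (i) if $c_1<\tfrac12$, $\overline{\mathrm{rc}}(G_n)=n+O(1)$; (ii) if $c_1=\tfrac12$, $\overline{\mathrm{rc}}(G_n)=n+O(n^{1/2})$; (iii) if $c_1>\tfrac12$, $\overline{\mathrm{rc}}(G_n)=2c_1n+O(1)$.
   Context: Robot crawler model: let $G=(V,E)$ be a finite connected simple graph with $|V|=n$. An initial weighting is a bijection $w_0:V\to\{-n,-n+1,\dots,-1\}$. At time $1$ the crawler visits $w_0^{-1}(-n)$. If the crawler visits vertex $v$ at time $t$, then $w_t(v)=t$ and $w_t(u)=w_{t-1}(u)$ for all $u\neq v$. If $\min_{y\in V}w_t(y)>0$, the process stops and $\mathcal{RC}(G,w_0):=t$. Otherwise, at time $t+1$ the crawler moves to the neighbour $u$ of $v$ minimising $w_t(u)$ (the weights are distinct, so this is well defined). A vertex is "cleaned" at the first time it is visited. With $\Omega_n$ the set of all $n!$ initial weightings, $\mathrm{rc}(G)=\min_{w_0\in\Omega_n}\mathcal{RC}(G,w_0)$, $\mathrm{RC}(G)=\max_{w_0\in\Omega_n}\mathcal{RC}(G,w_0)$, and $\overline{\mathrm{rc}}(G)=\mathbb{E}\,\mathcal{RC}(G,\overline{w_0})$ where $\overline{w_0}$ is uniformly distributed on $\Omega_n$.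 A complete $k$-partite graph with parts $V_1,\dots,V_k$ has an edge between $u$ and $v$ if and only if $u,v$ lie in different parts. *)

theory Defs
  imports Complex_Main
begin

text \<open>Robot crawler on a graph given by a vertex set V and an adjacency relation E
 (only neighbours inside V are considered). The state at time t (t \<ge> 1) is the pair
 (vertex visited at time t, weighting w_t). Time 0 is the initial weighting.\<close>

fun crawl :: "('a \<Rightarrow> 'a \<Rightarrow> bool) \<Rightarrow> 'a set \<Rightarrow> ('a \<Rightarrow> int) \<Rightarrow> nat \<Rightarrow> 'a \<times> ('a \<Rightarrow> int)" where
  "crawl E V w0 0 = (undefined, w0)"
| "crawl E V w0 (Suc 0) =
     (let v = (THE v. v \<in> V \<and> w0 v = - int (card V)) in (v, w0(v := 1)))"
| "crawl E V w0 (Suc (Suc t)) =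
     (let (v, w) = crawl E V w0 (Suc t);
          u = (THE u. u \<in> V \<and> E v u \<and> (\<forall>y\<in>V. E v y \<longrightarrow> w u \<le> w y))
      in (u, w(u := int (Suc (Suc t)))))"

definition rc_time :: "('a \<Rightarrow> 'a \<Rightarrow> bool) \<Rightarrow> 'a set \<Rightarrow> ('a \<Rightarrow> int) \<Rightarrow> nat" where
  "rc_time E V w0 = (LEAST t. 1 \<le> t \<and> (\<forall>y\<in>V. snd (crawl E V w0 t) y > 0))"

definition weightings :: "'a set \<Rightarrow> ('a \<Rightarrow> int) set" where
  "weightings V = {w. bij_betw w V {- int (card V) .. -1} \<and> (\<forall>x. x \<notin> V \<longrightarrow> w x = 0)}"

definition rc_avg :: "('a \<Rightarrow> 'a \<Rightarrow> bool) \<Rightarrow> 'a set \<Rightarrow> real" where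
  "rc_avg E V = (\<Sum>w\<in>weightings V. real (rc_time E V w)) / real (card (weightings V))"

definition kp_verts :: "nat \<Rightarrow> (nat \<Rightarrow> nat) \<Rightarrow> (nat \<times> nat) set" where
  "kp_verts k s = {(i, j). i < k \<and> j < s i}"

definition kp_adj :: "nat \<times> nat \<Rightarrow> nat \<times> nat \<Rightarrow> bool" where
  "kp_adj u v \<longleftrightarrow> fst u \<noteq> fst v"

text \<open>Part sizes c_i n (used only when all c_i n are integers).\<close>
definition part_sizes :: "(nat \<Rightarrow> real) \<Rightarrow> nat \<Rightarrow> nat \<Rightarrow> nat" where
  "part_sizes c n i = nat \<lfloor>c i * real n\<rfloor>"

definition rc_avg_kp :: "nat \<Rightarrow> (nat \<Rightarrow> real) \<Rightarrow> nat \<Rightarrow> real" where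
  "rc_avg_kp k c n = rc_avg kp_adj (kp_verts k (part_sizes c n))"

end

theory Submission
  imports Defs "HOL-Combinatorics.Multiset_Permutations"
begin

text \<open>Read the vertices in the order of their initial weights. The dirty vertices that the crawler
  has skipped all lie in one part, and their number evolves like the counter of the Boyer--Moore
  majority vote algorithm. Each vertex that is still skipped when the list is exhausted costs two
  more steps, so the crawler needs exactly \<open>n\<close> plus the final counter.

  For a part of size \<open>a\<close> consider the walk that goes up at its vertices and down at all others. The
  final counter is at most the largest increment of one of these walks over a final segment of the
  list. For a uniformly random order, the reflection principle gives the distribution of that
  increment: it exceeds a level \<open>h\<close> with a probability that is a quotient of binomial coefficients.
  Hence its mean is \<open>O(1)\<close> if \<open>a / n\<close> is bounded by a constant below \<open>1/2\<close>, and at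
  most \<open>2\<^sup>n\<close> divided by the central binomial coefficient, that is \<open>O(n\<^sup>1\<^sup>/\<^sup>2)\<close>, if \<open>2 a = n\<close>. If
  \<open>2 a > n\<close>, the largest increment over a final segment is the total drift \<open>2 a - n\<close> plus the largest
  increment over an initial segment of the walk of the complement, whose mean is \<open>O(1)\<close>; conversely
  the counter is never less than the drift minus 1.\<close>

section \<open>The crawler on complete multipartite graphs\<close>

definition all_clean :: "('a \<Rightarrow> 'a \<Rightarrow> bool) \<Rightarrow> 'a set \<Rightarrow> ('a \<Rightarrow> int) \<Rightarrow> nat \<Rightarrow> bool" where
  "all_clean E V w0 t \<longleftrightarrow> (\<forall>y\<in>V. snd (crawl E V w0 t) y > 0)"

text \<open>The exact waiting time is counted from an arbitrary time \<open>t\<close>, so that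
  single moves can be chained by induction; \<open>t = 1\<close> gives
  \<open>rc_time\<close>.\<close>

definition clean_after :: "('a \<Rightarrow> 'a \<Rightarrow> bool) \<Rightarrow> 'a set \<Rightarrow> ('a \<Rightarrow> int) \<Rightarrow> nat \<Rightarrow> nat \<Rightarrow> bool" where
  "clean_after E V w0 t d \<longleftrightarrow> all_clean E V w0 (t + d) \<and> (\<forall>e<d. \<not> all_clean E V w0 (t + e))"

lemma clean_after_Suc:
  assumes "\<not> all_clean E V w0 t" "clean_after E V w0 (Suc t) d"
  shows "clean_after E V w0 t (Suc d)"
  unfolding clean_after_def
proof (intro conjI allI impI)
  show "all_clean E V w0 (t + Suc d)" using assms(2) by (simp add: clean_after_def)
  show "\<not> all_clean E V w0 (t + e)" if "e < Suc d" for e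
    using that assms by (cases e) (auto simp: clean_after_def)
qed

lemma rc_time_eq:
  assumes "clean_after E V w0 1 d"
  shows "rc_time E V w0 = Suc d"
  unfolding rc_time_def
proof (rule Least_equality)
  show "1 \<le> Suc d \<and> (\<forall>y\<in>V. snd (crawl E V w0 (Suc d)) y > 0)"
    using assms by (auto simp: clean_after_def all_clean_def)
  fix t assume t: "1 \<le> t \<and> (\<forall>y\<in>V. snd (crawl E V w0 t) y > 0)"
  then have "all_clean E V w0 (1 + (t - 1))" by (simp add: all_clean_def)
  then have "\<not> t - 1 < d" using assms by (auto simp: clean_after_def)
  then show "Suc d \<le> t" using t by linarith
qed

text \<open>Injectivity of \<open>w\<close> makes the minimising neighbour unique, which resolves
  the \<open>THE\<close> in \<open>crawl\<close>.\<close>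

lemma crawl_step:
  assumes "crawl E V w0 t = (v, w)" "t \<ge> 1" "inj_on w V"
    and "u \<in> V" "E v u" "\<And>y. y \<in> V \<Longrightarrow> E v y \<Longrightarrow> w u \<le> w y"
  shows "crawl E V w0 (Suc t) = (u, w(u := int (Suc t)))"
proof -
  obtain s where s: "t = Suc s" using assms(2) by (cases t) auto
  have "(THE u. u \<in> V \<and> E v u \<and> (\<forall>y\<in>V. E v y \<longrightarrow> w u \<le> w y)) = u"
    using assms(4-6) by (intro the_equality) (auto intro: inj_onD[OF assms(3)] antisym)
  then show ?thesis using assms(1) by (simp add: s Let_def)
qed

text \<open>The list \<open>ds\<close> contains the dirty vertices in the order of their initial weights.\<close>

definition dirty_list :: "'a set \<Rightarrow> nat \<Rightarrow> 'a \<Rightarrow> ('a \<Rightarrow> int) \<Rightarrow> 'a list \<Rightarrow> bool" where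
  "dirty_list V t v w ds \<longleftrightarrow> v \<in> V \<and> inj_on w V \<and> (\<forall>y\<in>V. w y \<le> int t) \<and> set ds \<subseteq> V \<and>
     sorted_wrt (\<lambda>x y. w x < w y) ds \<and> (\<forall>y\<in>set ds. w y < 0) \<and> (\<forall>y\<in>V - set ds. w y > 0)"

lemma dirty_list_not_clean:
  assumes "crawl E V w0 t = (v, w)" "dirty_list V t v w ds" "ds \<noteq> []"
  shows "\<not> all_clean E V w0 t"
proof -
  have "hd ds \<in> set ds" using assms(3) by simp
  then have "hd ds \<in> V" "w (hd ds) < 0" using assms(2) by (auto simp: dirty_list_def)
  then show ?thesis using assms(1) unfolding all_clean_def by (metis less_asym snd_conv)
qed

lemma inj_on_fun_upd_fresh:
  assumes "inj_on w V" "\<forall>y\<in>V. w y \<le> int t"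
  shows "inj_on (w(u := int (Suc t))) V"
  using assms by (force simp: inj_on_def)

text \<open>The vertices in \<open>as\<close> share the crawler's part and are not adjacent to it.
  So \<open>d\<close> is the first dirty neighbour, and it beats every clean one because dirty
  weights are negative and clean ones positive.\<close>

lemma crawl_clean_step:
  fixes f :: "'a \<Rightarrow> 'b"
  assumes cr: "crawl (\<lambda>x y. f x \<noteq> f y) V w0 t = (v, w)" "t \<ge> 1"
    and inv: "dirty_list V t v w (as @ d # bs)"
    and as: "\<forall>a\<in>set as. f a = f v" and d: "f d \<noteq> f v"
  shows "\<exists>w'. crawl (\<lambda>x y. f x \<noteq> f y) V w0 (Suc t) = (d, w') \<and> dirty_list V (Suc t) d w' (as @ bs)"
proof (intro exI conjI)
  have dV: "d \<in> V" and inj: "inj_on w V" and le: "\<forall>y\<in>V. w y \<le> int t"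
    and srt: "sorted_wrt (\<lambda>x y. w x < w y) (as @ d # bs)"
    using inv by (auto simp: dirty_list_def)
  show "crawl (\<lambda>x y. f x \<noteq> f y) V w0 (Suc t) = (d, w(d := int (Suc t)))"
  proof (rule crawl_step[OF cr inj dV])
    show "f v \<noteq> f d" using d by simp
    fix y assume y: "y \<in> V" "f v \<noteq> f y"
    show "w d \<le> w y"
    proof (cases "y \<in> set (as @ d # bs)")
      case True
      then have "y = d \<or> y \<in> set bs" using as y by auto
      then show ?thesis using srt by (auto simp: sorted_wrt_append)
    next
      case False
      then have "w y > 0" "w d < 0" using inv y by (auto simp: dirty_list_def)
      then show ?thesis by simp
    qed
  qed
  have dn: "d \<notin> set as" "d \<notin> set bs" using srt by (auto simp: sorted_wrt_append)
  have "sorted_wrt (\<lambda>x y. (w(d := int (Suc t))) x < (w(d := int (Suc t))) y) (as @ bs)"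
  proof (rule sorted_wrt_mono_rel)
    show "sorted_wrt (\<lambda>x y. w x < w y) (as @ bs)" using srt by (simp add: sorted_wrt_append)
  qed (use dn in auto)
  then show "dirty_list V (Suc t) d (w(d := int (Suc t))) (as @ bs)"
    using inv dn inj_on_fun_upd_fresh[OF inj le, of d] by (auto simp: dirty_list_def)
qed

text \<open>With every dirty vertex in the crawler's own part, the move goes to a clean vertex.
  Which one does not matter later, only that it lies in another part.\<close>

lemma crawl_idle_step:
  fixes f :: "'a \<Rightarrow> 'b"
  assumes cr: "crawl (\<lambda>x y. f x \<noteq> f y) V w0 t = (v, w)" "t \<ge> 1"
    and inv: "dirty_list V t v w ds"
    and ds: "\<forall>a\<in>set ds. f a = f v" and ex: "\<exists>u\<in>V. f u \<noteq> f v" and fin: "finite V"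
  shows "\<exists>u w'. f u \<noteq> f v \<and> crawl (\<lambda>x y. f x \<noteq> f y) V w0 (Suc t) = (u, w') \<and>
    dirty_list V (Suc t) u w' ds"
proof -
  have inj: "inj_on w V" and le: "\<forall>y\<in>V. w y \<le> int t"
    and srt: "sorted_wrt (\<lambda>x y. w x < w y) ds"
    using inv by (auto simp: dirty_list_def)
  define N where "N = {u\<in>V. f u \<noteq> f v}"
  have "finite N" "N \<noteq> {}" using fin ex by (auto simp: N_def)
  then obtain u where u: "u \<in> N" "\<forall>y\<in>N. w u \<le> w y"
    by (metis arg_min_if_finite(1) arg_min_least)
  then have uV: "u \<in> V" and fu: "f u \<noteq> f v" by (auto simp: N_def)
  have un: "u \<notin> set ds" using fu ds by auto
  have "sorted_wrt (\<lambda>x y. (w(u := int (Suc t))) x < (w(u := int (Suc t))) y) ds"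
    by (rule sorted_wrt_mono_rel[OF _ srt]) (use un in auto)
  then have "dirty_list V (Suc t) u (w(u := int (Suc t))) ds"
    using inv un uV inj_on_fun_upd_fresh[OF inj le, of u] by (auto simp: dirty_list_def)
  moreover have "crawl (\<lambda>x y. f x \<noteq> f y) V w0 (Suc t) = (u, w(u := int (Suc t)))"
    by (rule crawl_step[OF cr inj uV]) (use u fu in \<open>auto simp: N_def\<close>)
  ultimately show ?thesis using fu by blast
qed

text \<open>A variant of the Boyer--Moore majority vote: \<open>p\<close> is the part of the crawler and \<open>m\<close> the
  number of skipped vertices, all of which lie in that part.\<close>

fun vote :: "('a \<Rightarrow> 'b) \<Rightarrow> 'b \<Rightarrow> nat \<Rightarrow> 'a list \<Rightarrow> nat" where
  "vote f p m [] = m"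
| "vote f p m (x # xs) =
     (if f x = p then vote f p (Suc m) xs
      else if m > 0 then vote f p (m - 1) xs
      else vote f (f x) 0 xs)"

text \<open>Each remaining vertex costs two moves: an idle one out of the part and one back to the
  first dirty vertex, after which the situation repeats.\<close>

lemma clean_after_same_part:
  fixes f :: "'a \<Rightarrow> 'b"
  assumes "crawl (\<lambda>x y. f x \<noteq> f y) V w0 t = (v, w)" "t \<ge> 1"
    and "dirty_list V t v w bs" "\<forall>b\<in>set bs. f b = f v"
    and "finite V" "\<forall>v\<in>V. \<exists>u\<in>V. f u \<noteq> f v"
  shows "clean_after (\<lambda>x y. f x \<noteq> f y) V w0 t (2 * length bs)"
  using assms(1-4)
proof (induction bs arbitrary: t v w)
  case Nil
  then show ?case by (auto simp: clean_after_def all_clean_def dirty_list_def)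
next
  case (Cons b bs)
  have "v \<in> V" using Cons.prems(3) by (simp add: dirty_list_def)
  then obtain u w' where u: "f u \<noteq> f v" "crawl (\<lambda>x y. f x \<noteq> f y) V w0 (Suc t) = (u, w')"
      "dirty_list V (Suc t) u w' (b # bs)"
    using crawl_idle_step[OF Cons.prems(1-4)] assms(5,6) by blast
  obtain w'' where w'': "crawl (\<lambda>x y. f x \<noteq> f y) V w0 (Suc (Suc t)) = (b, w'')"
      "dirty_list V (Suc (Suc t)) b w'' bs"
    using crawl_clean_step[OF u(2) _, of "[]" b bs] u(1,3) Cons.prems(4) by auto
  have "clean_after (\<lambda>x y. f x \<noteq> f y) V w0 (Suc (Suc t)) (2 * length bs)"
    using Cons.IH[OF w''(1) _ w''(2)] Cons.prems(4) by simp
  then show ?case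
    using dirty_list_not_clean[OF Cons.prems(1,3)] dirty_list_not_clean[OF u(2,3)]
    by (auto intro!: clean_after_Suc)
qed

text \<open>\<open>bs\<close> holds the skipped vertices, \<open>ys\<close> the unread ones. The
  cases for \<open>y\<close> mirror the equations of \<open>vote\<close>: a vertex of the current
  part joins \<open>bs\<close> without a move; any other is cleaned, and the crawler then returns at
  once to the head of \<open>bs\<close>, or adopts the new part if \<open>bs\<close> is
  empty.\<close>

lemma clean_after_vote:
  fixes f :: "'a \<Rightarrow> 'b"
  assumes "crawl (\<lambda>x y. f x \<noteq> f y) V w0 t = (v, w)" "t \<ge> 1"
    and "dirty_list V t v w (bs @ ys)" "\<forall>b\<in>set bs. f b = f v"
    and "finite V" "\<forall>v\<in>V. \<exists>u\<in>V. f u \<noteq> f v"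
  shows "clean_after (\<lambda>x y. f x \<noteq> f y) V w0 t
    (length bs + length ys + vote f (f v) (length bs) ys)"
  using assms(1-4)
proof (induction ys arbitrary: t v w bs)
  case Nil
  then show ?case
    using clean_after_same_part[OF Nil.prems(1,2) _ Nil.prems(4) assms(5,6)] by (simp add: mult_2)
next
  case (Cons y ys)
  show ?case
  proof (cases "f y = f v")
    case True
    then show ?thesis using Cons.IH[OF Cons.prems(1,2), of "bs @ [y]"] Cons.prems(3,4) by simp
  next
    case False
    obtain w' where w': "crawl (\<lambda>x y. f x \<noteq> f y) V w0 (Suc t) = (y, w')"
        "dirty_list V (Suc t) y w' (bs @ ys)"
      using crawl_clean_step[OF Cons.prems(1-4) False] by blast
    have nc: "\<not> all_clean (\<lambda>x y. f x \<noteq> f y) V w0 t"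
      using dirty_list_not_clean[OF Cons.prems(1,3)] by simp
    show ?thesis
    proof (cases bs)
      case Nil
      then show ?thesis
        using Cons.IH[OF w'(1), of "[]"] w'(2) False nc by (auto intro: clean_after_Suc)
    next
      case (Cons b cs)
      then have b: "f b = f v" "\<forall>b\<in>set cs. f b = f v" using Cons.prems(4) by auto
      obtain w'' where w'': "crawl (\<lambda>x y. f x \<noteq> f y) V w0 (Suc (Suc t)) = (b, w'')"
          "dirty_list V (Suc (Suc t)) b w'' (cs @ ys)"
        using crawl_clean_step[OF w'(1), of "[]" b "cs @ ys"] w'(2) False b Cons by auto
      have "\<not> all_clean (\<lambda>x y. f x \<noteq> f y) V w0 (Suc t)"
        using dirty_list_not_clean[OF w'] Cons by simp
      moreover have "clean_after (\<lambda>x y. f x \<noteq> f y) V w0 (Suc (Suc t))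
          (length cs + length ys + vote f (f v) (length cs) ys)"
        using Cons.IH[OF w''(1) _ w''(2)] b by simp
      ultimately show ?thesis using nc False Cons by (auto intro!: clean_after_Suc)
    qed
  qed
qed

section \<open>From weightings to permutations\<close>

definition initial_order :: "'a set \<Rightarrow> ('a \<Rightarrow> int) \<Rightarrow> 'a list" where
  "initial_order V w = map (inv_into V w) [- int (card V) .. -1]"

text \<open>Time 1 is spent on \<open>x\<close>; the wait from there is the length of
  \<open>xs\<close> plus the final counter.\<close>

lemma rc_time_multipartite:
  fixes f :: "'a \<Rightarrow> 'b"
  assumes w: "w \<in> weightings V" and V: "finite V" "\<forall>v\<in>V. \<exists>u\<in>V. f u \<noteq> f v"
    and xs: "initial_order V w = x # xs"
  shows "rc_time (\<lambda>x y. f x \<noteq> f y) V w = card V + vote f (f x) 0 xs"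
proof -
  let ?n = "int (card V)"
  have bij: "bij_betw w V {- ?n .. -1}" using w by (simp add: weightings_def)
  have n: "card V > 0" using xs by (cases "card V = 0") (auto simp: initial_order_def)
  have up: "[- ?n .. -1] = (- ?n) # [- ?n + 1 .. -1]" using n by (simp add: upto_rec1)
  have x: "x = inv_into V w (- ?n)" and xs': "xs = map (inv_into V w) [- ?n + 1 .. -1]"
    using xs by (auto simp: initial_order_def up)
  have inv: "inv_into V w i \<in> V" "w (inv_into V w i) = i" if "i \<in> {- ?n .. -1}" for i
    using bij that by (auto simp: bij_betw_def inv_into_into f_inv_into_f)
  have xV: "x \<in> V" "w x = - ?n" using inv[of "- ?n"] n by (auto simp: x)
  have inj: "inj_on w V" using bij by (simp add: bij_betw_def)
  have wV: "w y \<in> {- ?n .. -1}" if "y \<in> V" for y using bij that by (auto simp: bij_betw_def)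
  have "(THE v. v \<in> V \<and> w v = - ?n) = x"
    using xV by (intro the_equality) (auto intro: inj_onD[OF inj])
  then have cr: "crawl (\<lambda>x y. f x \<noteq> f y) V w 1 = (x, w(x := 1))" by (simp add: Let_def)
  have setxs: "y \<in> set xs \<longleftrightarrow> y \<in> V \<and> y \<noteq> x" for y
  proof
    assume "y \<in> set xs"
    then obtain i where "i \<in> {- ?n + 1 .. -1}" "y = inv_into V w i" by (auto simp: xs')
    then show "y \<in> V \<and> y \<noteq> x" using inv[of i] xV by auto
  next
    assume y: "y \<in> V \<and> y \<noteq> x"
    then have "w y \<noteq> w x" using inj_onD[OF inj, of y x] xV by auto
    then have "w y \<in> {- ?n + 1 .. -1}" using wV[of y] y xV by auto
    moreover have "y = inv_into V w (w y)" using y inj by simp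
    ultimately show "y \<in> set xs" unfolding xs' by force
  qed
  have "sorted_wrt (\<lambda>a b. (w(x := 1)) a < (w(x := 1)) b) xs"
  proof -
    have "sorted_wrt (<) [- ?n + 1 .. -1]" by simp
    then have "sorted_wrt (\<lambda>i j. w (inv_into V w i) < w (inv_into V w j)) [- ?n + 1 .. -1]"
      by (rule sorted_wrt_mono_rel[rotated]) (use inv in auto)
    then have "sorted_wrt (\<lambda>a b. w a < w b) xs" by (simp add: xs' sorted_wrt_map)
    then show ?thesis by (rule sorted_wrt_mono_rel[rotated]) (use setxs in auto)
  qed
  moreover have "inj_on (w(x := 1)) V"
    \<comment> \<open>All initial weights are at most 0, so the instance with time 0 covers the
      stamp 1.\<close>
    using inj_on_fun_upd_fresh[OF inj, of 0 x] wV by fastforce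
  moreover have "w y \<le> 1" "w y < 0" if "y \<in> V" for y using wV[OF that] by auto
  ultimately have "dirty_list V 1 x (w(x := 1)) ([] @ xs)"
    using xV setxs by (auto simp: dirty_list_def)
  from clean_after_vote[OF cr _ this _ V]
  have "clean_after (\<lambda>x y. f x \<noteq> f y) V w 1 (length xs + vote f (f x) 0 xs)" by simp
  moreover have "Suc (length xs) = card V" using n by (simp add: xs')
  ultimately show ?thesis using rc_time_eq by fastforce
qed

text \<open>Turns a uniformly random weighting into a uniformly random permutation. Injectivity
  relies on weightings being 0 outside \<open>V\<close>.\<close>

lemma bij_betw_initial_order:
  assumes "finite V"
  shows "bij_betw (initial_order V) (weightings V) (permutations_of_set V)"
  unfolding bij_betw_def
proof
  let ?n = "int (card V)"
  have bij: "bij_betw w V {- ?n .. -1}" if "w \<in> weightings V" for w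
    using that by (simp add: weightings_def)
  show "inj_on (initial_order V) (weightings V)"
  proof (rule inj_onI)
    fix w w' assume w: "w \<in> weightings V" "w' \<in> weightings V" 
      and eq: "initial_order V w = initial_order V w'"
    have *: "inv_into V w i = inv_into V w' i" if "i \<in> {- ?n .. -1}" for i
      using eq that by (auto simp: initial_order_def)
    show "w = w'"
    proof
      fix x
      show "w x = w' x"
      proof (cases "x \<in> V")
        case True
        then have "w x \<in> {- ?n .. -1}" using bij[OF w(1)] by (auto simp: bij_betw_def)
        from *[OF this] True show ?thesis using bij[OF w(1)] bij[OF w(2)] \<open>w x \<in> {- ?n .. -1}\<close>
          by (metis bij_betw_inv_into_left bij_betw_inv_into_right)
      qed (use w in \<open>auto simp: weightings_def\<close>)
    qed
  qed
  show "initial_order V ` weightings V = permutations_of_set V"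
  proof (intro equalityI subsetI)
    fix xs assume "xs \<in> initial_order V ` weightings V"
    then obtain w where w: "w \<in> weightings V" and xs: "xs = initial_order V w" by auto
    have "bij_betw (inv_into V w) {- ?n .. -1} V" using bij[OF w] by (rule bij_betw_inv_into)
    then show "xs \<in> permutations_of_set V"
      by (auto simp: xs initial_order_def permutations_of_set_def distinct_map bij_betw_def)
  next
    fix xs assume "xs \<in> permutations_of_set V"
    then have xs: "set xs = V" "distinct xs" by (auto simp: permutations_of_set_def)
    then have len: "length xs = card V" using distinct_card by fastforce
    define g where "g = (\<lambda>i. xs ! nat (i + ?n))"
    have g: "bij_betw g {- ?n .. -1} V"
    proof -
      have "bij_betw (\<lambda>i. nat (i + ?n)) {- ?n .. -1} {..<length xs}"
        by (rule bij_betw_byWitness[where f' = "\<lambda>j. int j - ?n"]) (auto simp: len)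
      moreover have "bij_betw ((!) xs) {..<length xs} V" using xs by (simp add: bij_betw_nth)
      ultimately show ?thesis unfolding g_def using bij_betw_trans[unfolded comp_def] by blast
    qed
    define w where "w = (\<lambda>x. if x \<in> V then inv_into {- ?n .. -1} g x else 0)"
    have bw: "bij_betw w V {- ?n .. -1}"
      using bij_betw_inv_into[OF g] by (subst bij_betw_cong[where g = "inv_into {- ?n .. -1} g"]) (auto simp: w_def)
    then have "w \<in> weightings V" by (simp add: weightings_def w_def)
    moreover have "initial_order V w = xs"
    proof (rule nth_equalityI)
      show "length (initial_order V w) = length xs" by (simp add: initial_order_def len)
      fix i assume "i < length (initial_order V w)"
      then have i: "i < card V" by (simp add: initial_order_def)
      let ?j = "- ?n + int i"
      have j: "?j \<in> {- ?n .. -1}" using i by simp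
      then have "g ?j \<in> V" using g by (auto simp: bij_betw_def)
      moreover have "w (g ?j) = ?j"
        using \<open>g ?j \<in> V\<close> j g by (simp add: w_def bij_betw_inv_into_left)
      ultimately have "inv_into V w ?j = g ?j" using bw by (metis bij_betw_inv_into_left)
      then show "initial_order V w ! i = xs ! i" using i by (simp add: initial_order_def g_def)
    qed
    ultimately show "xs \<in> initial_order V ` weightings V" by (auto simp: image_iff)
  qed
qed

section \<open>Maxima of random walks\<close>

text \<open>The maximum over all prefixes, the empty one included, of the walk that goes up
  at \<open>x\<close> if \<open>P x\<close> holds and down otherwise; truncated subtraction provides the maximum with 0.\<close>

fun walk_max :: "('a \<Rightarrow> bool) \<Rightarrow> 'a list \<Rightarrow> nat" where
  "walk_max P [] = 0"
| "walk_max P (x # xs) = (if P x then Suc (walk_max P xs) else walk_max P xs - 1)"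

text \<open>The endpoint of the walk: ups minus downs.\<close>

definition surplus :: "('a \<Rightarrow> bool) \<Rightarrow> 'a list \<Rightarrow> int" where
  "surplus P xs = 2 * int (length (filter P xs)) - int (length xs)"

lemma surplus_simps [simp]:
  "surplus P [] = 0"
  "surplus P (x # xs) = surplus P xs + (if P x then 1 else -1)"
  by (auto simp: surplus_def)

lemma surplus_le_walk_max: "surplus P xs \<le> int (walk_max P xs)"
  by (induction xs) auto

lemma walk_max_append_ge: "walk_max P xs \<le> walk_max P (xs @ ys)"
  by (induction xs) auto

lemma walk_max_le_length: "walk_max P xs \<le> length xs"
  by (induction xs) auto

lemma surplus_rev [simp]: "surplus P (rev xs) = surplus P xs"
  by (simp add: surplus_def flip: rev_filter)

lemma surplus_not: "surplus (\<lambda>x. \<not> P x) xs = - surplus P xs"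
  by (induction xs) auto

text \<open>The increment over an initial segment is the total increment minus that over the rest,
  and the latter, negated, is an increment of the complementary walk over an initial segment of the
  reversed list.\<close>

lemma walk_max_le_walk_max_not:
  "int (walk_max P xs) \<le> surplus P xs + int (walk_max (\<lambda>x. \<not> P x) (rev xs))"
proof (induction xs)
  case (Cons x xs)
  have "walk_max (\<lambda>x. \<not> P x) (rev xs) \<le> walk_max (\<lambda>x. \<not> P x) (rev (x # xs))"
    by (simp add: walk_max_append_ge)
  \<comment> \<open>Covers the case where the truncated subtraction in \<open>walk_max\<close> stops
    at 0.\<close>
  moreover have "surplus (\<lambda>x. \<not> P x) (rev (x # xs)) \<le> int (walk_max (\<lambda>x. \<not> P x) (rev (x # xs)))"
    by (rule surplus_le_walk_max)
  ultimately show ?case using Cons.IH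
    by (cases "walk_max P xs") (auto simp: surplus_not surplus_rev simp del: rev.simps)
qed simp

text \<open>\<open>zs\<close> is the portion already read, latest vertex first, so reading
  \<open>y\<close> prepends it and final segments become initial ones. The counter moves with the
  walk of \<open>p\<close>; a switch of part restarts at 0, which is below every maximum.\<close>

lemma vote_le_walk_max:
  assumes "m \<le> walk_max (\<lambda>x. f x = p) zs"
  shows "\<exists>q\<in>insert p (f ` set ys). vote f p m ys \<le> walk_max (\<lambda>x. f x = q) (rev ys @ zs)"
  using assms
proof (induction ys arbitrary: p m zs)
  case (Cons y ys)
  consider "f y = p" | "f y \<noteq> p" "m > 0" | "f y \<noteq> p" "m = 0" by blast
  then show ?case
  proof cases
    case 1
    then show ?thesis using Cons.IH[of "Suc m" p "y # zs"] Cons.prems by auto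
  next
    case 2
    then have "m - 1 \<le> walk_max (\<lambda>x. f x = p) (y # zs)" using Cons.prems by simp
    then show ?thesis using Cons.IH[of "m - 1" p "y # zs"] 2 by auto
  next
    case 3
    then show ?thesis using Cons.IH[of 0 "f y" "y # zs"] by auto
  qed
qed simp

text \<open>\<open>s\<close> is the surplus of \<open>q\<close> so far. It stays at most
  \<open>m + 1\<close> while \<open>q\<close> is the current part and at most \<open>- m\<close>
  otherwise; the extra 1 accounts for the vertex that starts a part, which is visited and not
  skipped.\<close>

lemma vote_ge_surplus:
  assumes "s \<le> (if p = q then int m + 1 else - int m)"
  shows "s + surplus (\<lambda>x. f x = q) ys \<le> int (vote f p m ys) + 1"
  using assms
proof (induction ys arbitrary: p m s)
  case (Cons y ys)
  consider "f y = p" | "f y \<noteq> p" "m > 0" | "f y \<noteq> p" "m = 0" by blast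
  then show ?case
  proof cases
    case 1
    then show ?thesis
      using Cons.IH[of "s + (if f y = q then 1 else -1)" p "Suc m"] Cons.prems
      by (auto split: if_splits)
  next
    case 2
    then show ?thesis
      using Cons.IH[of "s + (if f y = q then 1 else -1)" p "m - 1"] Cons.prems
      by (auto split: if_splits)
  next
    case 3
    then show ?thesis
      using Cons.IH[of "s + (if f y = q then 1 else -1)" "f y" 0] Cons.prems
      by (auto split: if_splits)
  qed
qed (auto split: if_splits)

section \<open>Counting permutations by the maximum of their walk\<close>

lemma card_split:
  assumes "finite V"
  shows "card V = card {x\<in>V. P x} + card {x\<in>V. \<not> P x}"
  using assms by (subst card_Un_disjoint[symmetric]) (auto intro: arg_cong[of _ _ card])

text \<open>The reflection principle. The hypothesis says that the walk ends at or below level \<open>h\<close>;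
  it is preserved by the first step, so the count obeys Pascal's rule.\<close>

lemma card_walk_max_ge:
  assumes "finite V" "card {x\<in>V. P x} \<le> card {x\<in>V. \<not> P x} + h"
  shows "card {xs\<in>permutations_of_set V. h \<le> walk_max P xs} =
    fact (card {x\<in>V. P x}) * fact (card {x\<in>V. \<not> P x}) * (card V choose (card {x\<in>V. \<not> P x} + h))"
  using assms
proof (induction "card V" arbitrary: V h rule: less_induct)
  case less
  define a b where "a = card {x\<in>V. P x}" and "b = card {x\<in>V. \<not> P x}"
  have fin: "finite V" by fact
  have n: "card V = a + b"
    unfolding a_def b_def by (rule card_split[OF fin])
  have ab: "a \<le> b + h" using less.prems by (simp add: a_def b_def)
  show ?case
  proof (cases h)
    case 0
    have "fact a * fact b * (a + b choose b) = (fact (a + b) :: nat)"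
      using binomial_fact_lemma[of b "a + b"] by (simp add: mult_ac)
    then show ?thesis using 0 fin by (simp add: n flip: a_def b_def)
  next
    case (Suc g)
    show ?thesis
    proof (cases "V = {}")
      case True
      then show ?thesis using Suc by simp
    next
      case False
      then have n0: "a + b > 0" using fin by (metis n card_gt_0_iff)
      \<comment> \<open>An up-step lowers the level still to be reached from \<open>g + 1\<close> to
        \<open>g\<close>, a down-step raises it to \<open>g + 2\<close>.\<close>
      define S where "S = (\<lambda>x. {xs\<in>permutations_of_set (V - {x}).
        (if P x then g else g + 2) \<le> walk_max P xs})"
      have "{xs\<in>permutations_of_set V. h \<le> walk_max P xs} = (\<Union>x\<in>V. (#) x ` S x)"
        unfolding permutations_of_set_nonempty[OF False] S_def Suc
        by (auto split: if_splits)
      then have "card {xs\<in>permutations_of_set V. h \<le> walk_max P xs} = (\<Sum>x\<in>V. card ((#) x ` S x))"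
        using fin by (simp only:) (rule card_UN_disjoint, auto simp: S_def)
      also have "\<dots> = (\<Sum>x\<in>V. card (S x))"
        by (simp add: card_image)
      also have "\<dots> = (\<Sum>x\<in>V. if P x then fact (a - 1) * fact b * (a + b - 1 choose (b + g))
                                else fact a * fact (b - 1) * (a + b - 1 choose (b + g + 1)))"
      proof (rule sum.cong[OF refl])
        fix x assume x: "x \<in> V"
        have less_V: "card (V - {x}) < card V" using fin x by (rule card_Diff1_less)
        have cV: "card (V - {x}) = a + b - 1" using x fin n by simp
        show "card (S x) = (if P x then fact (a - 1) * fact b * (a + b - 1 choose (b + g))
                                else fact a * fact (b - 1) * (a + b - 1 choose (b + g + 1)))"
        proof (cases "P x")
          case True
          have "{y\<in>V - {x}. P y} = {y\<in>V. P y} - {x}" "{y\<in>V - {x}. \<not> P y} = {y\<in>V. \<not> P y}"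
            using True by auto
          then have c: "card {y\<in>V - {x}. P y} = a - 1" "card {y\<in>V - {x}. \<not> P y} = b"
            using x True fin by (simp_all add: a_def b_def)
          show ?thesis
            using less.hyps[OF less_V, of g] fin True ab Suc unfolding c cV by (simp add: S_def)
        next
          case False
          have "{y\<in>V - {x}. P y} = {y\<in>V. P y}" "{y\<in>V - {x}. \<not> P y} = {y\<in>V. \<not> P y} - {x}"
            using False by auto
          then have c: "card {y\<in>V - {x}. P y} = a" "card {y\<in>V - {x}. \<not> P y} = b - 1"
            using x False fin by (simp_all add: a_def b_def)
          have "b > 0" using x False fin by (auto simp: b_def card_gt_0_iff)
          then show ?thesis
            using less.hyps[OF less_V, of "g + 2"] fin False ab Suc unfolding c cV by (simp add: S_def)
        qed
      qed
      also have "\<dots> = a * (fact (a - 1) * fact b * (a + b - 1 choose (b + g)))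
                     + b * (fact a * fact (b - 1) * (a + b - 1 choose (b + g + 1)))"
        using fin by (simp add: sum.If_cases a_def b_def Int_def)
      \<comment> \<open>If \<open>a = 0\<close>, the left side is 0 and the binomial coefficient on
        the right vanishes because \<open>b > 0\<close>; the twin identity for \<open>b = 0\<close>
        uses the bound \<open>ab\<close>.\<close>
      also have "a * (fact (a - 1) * fact b * (a + b - 1 choose (b + g))) =
                 fact a * fact b * (a + b - 1 choose (b + g))"
        using n0 by (cases a) (auto simp: binomial_eq_0 algebra_simps)
      also have "b * (fact a * fact (b - 1) * (a + b - 1 choose (b + g + 1))) =
                 fact a * fact b * (a + b - 1 choose (b + g + 1))"
        using n0 ab Suc by (cases b) (auto simp: binomial_eq_0 algebra_simps)
      also have "fact a * fact b * (a + b - 1 choose (b + g)) + fact a * fact b * (a + b - 1 choose (b + g + 1))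
        = fact a * fact b * (a + b choose (b + h))"
        using n0 Suc by (cases "a + b") (auto simp: algebra_simps)
      finally show ?thesis by (simp add: n flip: a_def b_def)
    qed
  qed
qed

section \<open>The mean maximum for a random order\<close>

definition mean_walk_max :: "'a set \<Rightarrow> ('a \<Rightarrow> bool) \<Rightarrow> real" where
  "mean_walk_max V P = (\<Sum>xs\<in>permutations_of_set V. real (walk_max P xs)) / fact (card V)"

text \<open>The mean is the sum of the tail probabilities at the levels \<open>Suc h\<close>; the
  reflection count turns each into a quotient of binomial coefficients.\<close>

lemma mean_walk_max_eq:
  assumes "finite V" "card {x\<in>V. P x} \<le> card {x\<in>V. \<not> P x}"
  defines "b \<equiv> card {x\<in>V. \<not> P x}"
  shows "mean_walk_max V P =
    (\<Sum>h<card V. real (card V choose (b + Suc h))) / real (card V choose b)"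
proof -
  let ?n = "card V" let ?\<Pi> = "permutations_of_set V"
  define a where "a = card {x\<in>V. P x}"
  have n: "?n = a + b"
    unfolding a_def b_def by (rule card_split[OF assms(1)])
  have "walk_max P xs = (\<Sum>h<?n. of_bool (Suc h \<le> walk_max P xs))" if "xs \<in> ?\<Pi>" for xs
  proof -
    have "walk_max P xs \<le> ?n"
      using walk_max_le_length[of P xs] that by (simp add: length_finite_permutations_of_set)
    then have "{h. h < ?n \<and> Suc h \<le> walk_max P xs} = {..<walk_max P xs}" by auto
    then show ?thesis by (simp add: Int_def)
  qed
  then have "(\<Sum>xs\<in>?\<Pi>. walk_max P xs) = (\<Sum>xs\<in>?\<Pi>. \<Sum>h<?n. of_bool (Suc h \<le> walk_max P xs))"
    by (intro sum.cong) auto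
  also have "\<dots> = (\<Sum>h<?n. card {xs\<in>?\<Pi>. Suc h \<le> walk_max P xs})"
    by (subst sum.swap) (simp add: Int_def)
  also have "\<dots> = (\<Sum>h<?n. fact a * fact b * (?n choose (b + Suc h)))"
    using assms(1,2) by (intro sum.cong refl) (simp add: card_walk_max_ge a_def b_def)
  also have "\<dots> = fact a * fact b * (\<Sum>h<?n. ?n choose (b + Suc h))"
    by (simp add: sum_distrib_left)
  finally have "real (\<Sum>xs\<in>?\<Pi>. walk_max P xs) = fact a * fact b * real (\<Sum>h<?n. ?n choose (b + Suc h))"
    by (simp del: of_nat_sum)
  moreover have "fact ?n = (fact a * fact b * real (?n choose b) :: real)"
    using binomial_fact_lemma[of b ?n, THEN arg_cong[of _ _ real]] by (simp add: n mult_ac)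
  ultimately show ?thesis by (simp add: mean_walk_max_def)
qed

lemma Suc_times_binomial_eq_diff: "Suc k * (n choose Suc k) = (n - k) * (n choose k)"
  by (metis Suc_times_binomial_eq binomial_absorb_comp binomial_absorption)

text \<open>Consecutive binomial coefficients from \<open>b\<close> on have ratio at most
  \<open>a / (b + 1)\<close>. Summing gives \<open>(b + 1) * T \<le> a * ((n choose b) + T)\<close>,
  which is solved for \<open>T\<close> in place of summing a geometric series.\<close>

lemma mean_walk_max_le:
  assumes "finite V" "real (card {x\<in>V. P x}) \<le> \<alpha> * real (card V)" "\<alpha> < 1/2"
  shows "mean_walk_max V P \<le> 1 / (1 - 2 * \<alpha>)"
proof (cases "V = {}")
  case True
  then show ?thesis using assms by (simp add: mean_walk_max_def)
next
  case False
  let ?n = "card V"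
  define a b where "a = card {x\<in>V. P x}" and "b = card {x\<in>V. \<not> P x}"
  have n: "?n = a + b"
    unfolding a_def b_def by (rule card_split[OF assms(1)])
  have n0: "?n > 0" using False assms(1) by (simp add: card_gt_0_iff)
  have gap: "real b - real a \<ge> (1 - 2 * \<alpha>) * ?n"
    using assms(2) by (simp add: n flip: a_def) (simp add: algebra_simps)
  have pos: "(1 - 2 * \<alpha>) * ?n > 0" using n0 assms(3) by simp
  have ab: "a \<le> b" using gap pos by linarith
  define T where "T = (\<Sum>h<?n. ?n choose (b + Suc h))"
  have C0: "(?n choose b) > 0" by (simp add: n)
  have "Suc b * T \<le> (\<Sum>h<?n. a * (?n choose (b + h)))"
    unfolding T_def sum_distrib_left
  proof (rule sum_mono)
    fix h
    have "Suc b * (?n choose (b + Suc h)) \<le> Suc (b + h) * (?n choose Suc (b + h))"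
      by (simp add: mult_right_mono)
    also have "\<dots> = (?n - (b + h)) * (?n choose (b + h))" by (rule Suc_times_binomial_eq_diff)
    also have "\<dots> \<le> a * (?n choose (b + h))" by (rule mult_right_mono) (auto simp: n)
    finally show "Suc b * (?n choose (b + Suc h)) \<le> a * (?n choose (b + h))" .
  qed
  also have "\<dots> = a * (\<Sum>h<?n. ?n choose (b + h))" by (simp add: sum_distrib_left)
  also have "(\<Sum>h<?n. ?n choose (b + h)) \<le> (\<Sum>h<Suc ?n. ?n choose (b + h))" by simp
  also have "\<dots> = (?n choose b) + T" unfolding T_def by (subst sum.lessThan_Suc_shift) simp
  finally have "Suc b * T \<le> a * ((?n choose b) + T)" by simp
  then have "real (Suc b * T) \<le> real (a * ((?n choose b) + T))" by (rule of_nat_mono)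
  then have "(real b - real a) * T \<le> a * real (?n choose b)" by (simp add: algebra_simps)
  moreover have "(1 - 2 * \<alpha>) * ?n * T \<le> (real b - real a) * T" using gap by (rule mult_right_mono) simp
  moreover have "a * real (?n choose b) \<le> ?n * real (?n choose b)" by (rule mult_right_mono) (auto simp: n)
  ultimately have "?n * ((1 - 2 * \<alpha>) * T) \<le> ?n * real (?n choose b)" by (simp add: mult_ac)
  then have "(1 - 2 * \<alpha>) * T \<le> real (?n choose b)" using n0 by simp
  then have "T / real (?n choose b) \<le> 1 / (1 - 2 * \<alpha>)"
    using C0 assms(3) by (simp add: field_simps)
  moreover have "mean_walk_max V P = T / real (?n choose b)"
    using mean_walk_max_eq[OF assms(1), of P] ab by (simp add: T_def a_def b_def)
  ultimately show ?thesis by simp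
qed

section \<open>A lower bound for the central binomial coefficient\<close>

lemma central_binomial_Suc: "Suc a * (2 * Suc a choose Suc a) = 2 * (2 * a + 1) * (2 * a choose a)"
proof -
  have "Suc a * (2 * Suc a choose Suc a) = 2 * Suc a * (Suc (2 * a) choose a)"
    using Suc_times_binomial[of a "Suc (2 * a)"] by simp
  also have "Suc (2 * a) choose a = Suc (2 * a) choose Suc a"
    using binomial_symmetric[of a "Suc (2 * a)"] by simp
  also have "2 * Suc a * (Suc (2 * a) choose Suc a) = 2 * (Suc (2 * a) * (2 * a choose a))"
    using Suc_times_binomial[of a "2 * a"] by simp
  finally show ?thesis by simp
qed

text \<open>Squaring gives an inequality of natural numbers with equality at \<open>a = 1\<close>;
  the induction step reduces to \<open>4 * a * (a + 1) \<le> (2 * a + 1) ^ 2\<close>.\<close>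

lemma central_binomial_ge:
  assumes "a \<ge> 1"
  shows "4 ^ a \<le> 2 * sqrt (real a) * real (2 * a choose a)"
proof -
  have "16 ^ a \<le> 4 * a * (2 * a choose a)\<^sup>2"
    using assms
  proof (induction a rule: dec_induct)
    case (step a)
    have "Suc a * 16 ^ Suc a \<le> Suc a * (64 * a * (2 * a choose a)\<^sup>2)"
      using mult_left_mono[OF step.IH, of "16 * Suc a"] by (simp only: power_Suc mult_ac) simp
    also have "\<dots> \<le> 4 * (2 * (2 * a + 1) * (2 * a choose a))\<^sup>2"
      by (simp add: power2_eq_square algebra_simps)
    also have "\<dots> = Suc a * (4 * Suc a * (2 * Suc a choose Suc a)\<^sup>2)"
      by (subst central_binomial_Suc[symmetric]) (simp only: power2_eq_square mult_ac)
    finally show ?case by (simp only: mult_le_cancel1)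
  qed (simp add: numeral_eq_Suc)
  then have "real (16 ^ a) \<le> real (4 * a * (2 * a choose a)\<^sup>2)" by (rule of_nat_mono)
  moreover have "((4::real) ^ a)\<^sup>2 = 16 ^ a" by (simp flip: power_mult_distrib add: power2_eq_square)
  ultimately have "(4 ^ a)\<^sup>2 \<le> (2 * sqrt (real a) * real (2 * a choose a))\<^sup>2"
    by (simp add: power_mult_distrib)
  then show ?thesis by (rule power2_le_imp_le) simp
qed

text \<open>The numerators in \<open>mean_walk_max_eq\<close> add up to at most the whole row sum
  \<open>2 ^ n\<close>, and the denominator is the central binomial coefficient.\<close>

lemma mean_walk_max_balanced_le:
  assumes "finite V" "V \<noteq> {}" "2 * card {x\<in>V. P x} = card V"
  shows "mean_walk_max V P \<le> 2 * sqrt (real (card V))"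
proof -
  let ?n = "card V"
  define a b where "a = card {x\<in>V. P x}" and "b = card {x\<in>V. \<not> P x}"
  have n: "?n = a + b"
    unfolding a_def b_def by (rule card_split[OF assms(1)])
  then have ba: "b = a" and n2: "?n = 2 * a" using assms(3) by (auto simp: a_def)
  have a1: "a \<ge> 1" using assms(1,2) n2 by (metis One_nat_def Suc_leI card_gt_0_iff mult_0_right neq0_conv)
  have C0: "real (2 * a choose a) > 0" by simp
  have "(\<Sum>h<?n. ?n choose (b + Suc h)) = (\<Sum>j\<in>(\<lambda>h. b + Suc h) ` {..<?n}. ?n choose j)"
    by (subst sum.reindex) (auto simp: inj_on_def)
  also have "\<dots> \<le> (\<Sum>j\<in>(\<lambda>h. b + Suc h) ` {..<?n} \<union> {..?n}. ?n choose j)"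
    by (rule sum_mono2) auto
  also have "\<dots> = (\<Sum>j\<le>?n. ?n choose j)"
    by (rule sum.mono_neutral_right) (auto simp: binomial_eq_0)
  also have "\<dots> = 2 ^ ?n" by (rule choose_row_sum)
  finally have "real (\<Sum>h<?n. ?n choose (b + Suc h)) \<le> real (2 ^ ?n)" by (rule of_nat_mono)
  also have "\<dots> = 4 ^ a" by (simp add: n2 power_mult)
  also have "\<dots> \<le> 2 * sqrt a * (2 * a choose a)" using a1 by (rule central_binomial_ge)
  finally have "mean_walk_max V P \<le> 2 * sqrt a"
    using mean_walk_max_eq[OF assms(1), of P] C0
    by (simp add: ba n2 divide_le_eq flip: a_def b_def)
  also have "\<dots> \<le> 2 * sqrt ?n" by (simp add: n2)
  finally show ?thesis .
qed

section \<open>The mean crawling time\<close>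

text \<open>The crawler starts on the first vertex, which sets the current part and is not counted
  as skipped.\<close>

definition final_vote :: "('a \<Rightarrow> 'b) \<Rightarrow> 'a list \<Rightarrow> nat" where
  "final_vote f xs = vote f (f (hd xs)) 0 (tl xs)"

lemma final_vote_le:
  assumes "xs \<noteq> []"
  shows "\<exists>q\<in>f ` set xs. final_vote f xs \<le> walk_max (\<lambda>x. f x = q) (rev xs)"
proof -
  obtain x ys where xs: "xs = x # ys" using assms by (cases xs) auto
  show ?thesis using vote_le_walk_max[of 0 f "f x" "[x]" ys] by (auto simp: xs final_vote_def)
qed

lemma surplus_le_final_vote:
  assumes "xs \<noteq> []"
  shows "surplus (\<lambda>x. f x = q) xs \<le> int (final_vote f xs) + 1"
proof -
  obtain x ys where xs: "xs = x # ys" using assms by (cases xs) auto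
  show ?thesis
    using vote_ge_surplus[of "if f x = q then 1 else -1" "f x" q 0 f ys]
    by (auto simp: xs final_vote_def)
qed

lemma rc_avg_multipartite:
  fixes f :: "'a \<Rightarrow> 'b"
  assumes V: "finite V" "V \<noteq> {}" "\<forall>v\<in>V. \<exists>u\<in>V. f u \<noteq> f v"
  shows "rc_avg (\<lambda>x y. f x \<noteq> f y) V =
    real (card V) + (\<Sum>xs\<in>permutations_of_set V. real (final_vote f xs)) / fact (card V)"
proof -
  let ?\<Pi> = "permutations_of_set V" let ?E = "\<lambda>x y. f x \<noteq> f y"
  have bij: "bij_betw (initial_order V) (weightings V) ?\<Pi>"
    using V(1) by (rule bij_betw_initial_order)
  have "rc_time ?E V w = card V + final_vote f (initial_order V w)" if "w \<in> weightings V" for w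
  proof -
    have "initial_order V w \<in> ?\<Pi>" using bij that by (auto simp: bij_betw_def)
    then have "initial_order V w \<noteq> []" using V(2) by (auto simp: permutations_of_set_def)
    then obtain x xs where "initial_order V w = x # xs" by (cases "initial_order V w") auto
    then show ?thesis using rc_time_multipartite[OF that V(1,3)] by (simp add: final_vote_def)
  qed
  then have "(\<Sum>w\<in>weightings V. real (rc_time ?E V w)) =
      (\<Sum>w\<in>weightings V. real (card V) + real (final_vote f (initial_order V w)))"
    by (intro sum.cong) auto
  also have "\<dots> = (\<Sum>xs\<in>?\<Pi>. real (card V) + real (final_vote f xs))"
    using bij by (rule sum.reindex_bij_betw)
  finally show ?thesis
    using bij_betw_same_card[OF bij] V(1)
    by (simp add: rc_avg_def sum.distrib add_divide_distrib)
qed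

text \<open>Reversal permutes the orders, so maxima over final and over initial segments have the
  same mean.\<close>

lemma mean_walk_max_rev:
  "mean_walk_max V P = (\<Sum>xs\<in>permutations_of_set V. real (walk_max P (rev xs))) / fact (card V)"
proof -
  have "(\<Sum>xs\<in>permutations_of_set V. real (walk_max P xs)) =
      (\<Sum>xs\<in>rev ` permutations_of_set V. real (walk_max P xs))" by simp
  also have "\<dots> = (\<Sum>xs\<in>permutations_of_set V. real (walk_max P (rev xs)))"
    by (subst sum.reindex) auto
  finally show ?thesis by (simp add: mean_walk_max_def)
qed

lemma surplus_permutation:
  assumes "xs \<in> permutations_of_set V"
  shows "surplus P xs = 2 * int (card {x\<in>V. P x}) - int (card V)"
proof -
  have xs: "distinct xs" "set xs = V" using assms by (auto simp: permutations_of_set_def)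
  have "length (filter P xs) = card {x\<in>V. P x}"
    using distinct_card[of "filter P xs"] xs by (auto simp: Int_def conj_commute)
  moreover have "length xs = card V" using distinct_card[of xs] xs by simp
  ultimately show ?thesis by (simp add: surplus_def)
qed

text \<open>Both bounds hold for every single order: the counter is nonnegative and at least the
  drift of \<open>q\<close> minus 1, and that drift depends only on the size of the part.\<close>

lemma rc_avg_ge:
  fixes f :: "'a \<Rightarrow> 'b"
  assumes V: "finite V" "V \<noteq> {}" "\<forall>v\<in>V. \<exists>u\<in>V. f u \<noteq> f v"
  shows "rc_avg (\<lambda>x y. f x \<noteq> f y) V \<ge> real (card V)"
    and "rc_avg (\<lambda>x y. f x \<noteq> f y) V \<ge> 2 * real (card {x\<in>V. f x = q}) - 1"
proof -
  let ?\<Pi> = "permutations_of_set V"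
  show "rc_avg (\<lambda>x y. f x \<noteq> f y) V \<ge> real (card V)"
    unfolding rc_avg_multipartite[OF V] by (simp add: sum_nonneg)
  have "2 * real (card {x\<in>V. f x = q}) - real (card V) - 1 \<le> real (final_vote f xs)"
    if "xs \<in> ?\<Pi>" for xs
  proof -
    have "xs \<noteq> []" using that V(2) by (auto simp: permutations_of_set_def)
    from surplus_le_final_vote[OF this, of f q]
    have "2 * int (card {x\<in>V. f x = q}) - int (card V) \<le> int (final_vote f xs) + 1"
      using surplus_permutation[OF that] by simp
    then show ?thesis by linarith
  qed
  then have "(\<Sum>xs\<in>?\<Pi>. 2 * real (card {x\<in>V. f x = q}) - real (card V) - 1)
      \<le> (\<Sum>xs\<in>?\<Pi>. real (final_vote f xs))" by (rule sum_mono)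
  then have "2 * real (card {x\<in>V. f x = q}) - real (card V) - 1
      \<le> (\<Sum>xs\<in>?\<Pi>. real (final_vote f xs)) / fact (card V)"
    using V(1) by (simp add: le_divide_eq mult.commute)
  then show "rc_avg (\<lambda>x y. f x \<noteq> f y) V \<ge> 2 * real (card {x\<in>V. f x = q}) - 1"
    unfolding rc_avg_multipartite[OF V] by linarith
qed

text \<open>The part whose walk bounds the counter depends on the order; summing over all parts
  avoids identifying it.\<close>

lemma rc_avg_le:
  fixes f :: "'a \<Rightarrow> 'b"
  assumes V: "finite V" "V \<noteq> {}" "\<forall>v\<in>V. \<exists>u\<in>V. f u \<noteq> f v"
  shows "rc_avg (\<lambda>x y. f x \<noteq> f y) V \<le> real (card V) + (\<Sum>q\<in>f ` V. mean_walk_max V (\<lambda>x. f x = q))"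
proof -
  let ?\<Pi> = "permutations_of_set V"
  have "real (final_vote f xs) \<le> (\<Sum>q\<in>f ` V. real (walk_max (\<lambda>x. f x = q) (rev xs)))"
    if "xs \<in> ?\<Pi>" for xs
  proof -
    have "xs \<noteq> []" "set xs = V" using that V(2) by (auto simp: permutations_of_set_def)
    then obtain q where q: "q \<in> f ` V" "final_vote f xs \<le> walk_max (\<lambda>x. f x = q) (rev xs)"
      using final_vote_le[of xs f] by auto
    have "real (walk_max (\<lambda>x. f x = q) (rev xs)) \<le> (\<Sum>q\<in>f ` V. real (walk_max (\<lambda>x. f x = q) (rev xs)))"
      using q(1) V(1) by (intro member_le_sum) auto
    then show ?thesis using q(2) by linarith
  qed
  then have "(\<Sum>xs\<in>?\<Pi>. real (final_vote f xs)) \<le>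
      (\<Sum>xs\<in>?\<Pi>. \<Sum>q\<in>f ` V. real (walk_max (\<lambda>x. f x = q) (rev xs)))" by (rule sum_mono)
  also have "\<dots> = (\<Sum>q\<in>f ` V. \<Sum>xs\<in>?\<Pi>. real (walk_max (\<lambda>x. f x = q) (rev xs)))"
    by (rule sum.swap)
  finally show ?thesis
    unfolding rc_avg_multipartite[OF V] mean_walk_max_rev
    by (simp add: divide_right_mono flip: sum_divide_distrib)
qed

text \<open>For \<open>p\<close>, \<open>walk_max_le_walk_max_not\<close> bounds the maximum by the
  drift \<open>?d\<close> plus the maximum for the complement; the other parts enter through the
  sum.\<close>

lemma rc_avg_le_majority:
  fixes f :: "'a \<Rightarrow> 'b"
  assumes V: "finite V" "V \<noteq> {}" "\<forall>v\<in>V. \<exists>u\<in>V. f u \<noteq> f v"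
    and maj: "card V \<le> 2 * card {x\<in>V. f x = p}"
  shows "rc_avg (\<lambda>x y. f x \<noteq> f y) V \<le> 2 * real (card {x\<in>V. f x = p})
    + mean_walk_max V (\<lambda>x. f x \<noteq> p) + (\<Sum>q\<in>f ` V - {p}. mean_walk_max V (\<lambda>x. f x = q))"
proof -
  let ?\<Pi> = "permutations_of_set V"
  let ?d = "2 * real (card {x\<in>V. f x = p}) - real (card V)"
  let ?S = "\<lambda>xs. (\<Sum>q\<in>f ` V - {p}. real (walk_max (\<lambda>x. f x = q) (rev xs)))"
  have "real (final_vote f xs) \<le> ?d + real (walk_max (\<lambda>x. f x \<noteq> p) xs) + ?S xs"
    if "xs \<in> ?\<Pi>" for xs
  proof -
    have "xs \<noteq> []" "set xs = V" using that V(2) by (auto simp: permutations_of_set_def)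
    then obtain q where q: "q \<in> f ` V" "final_vote f xs \<le> walk_max (\<lambda>x. f x = q) (rev xs)"
      using final_vote_le[of xs f] by auto
    show ?thesis
    proof (cases "q = p")
      case True
      have "int (walk_max (\<lambda>x. f x = p) (rev xs)) \<le>
          2 * int (card {x\<in>V. f x = p}) - int (card V) + int (walk_max (\<lambda>x. f x \<noteq> p) xs)"
        using walk_max_le_walk_max_not[of "\<lambda>x. f x = p" "rev xs"] surplus_permutation[OF that]
        by simp
      then have "real (final_vote f xs) \<le> ?d + real (walk_max (\<lambda>x. f x \<noteq> p) xs)"
        using q(2) unfolding True by linarith
      moreover have "?S xs \<ge> 0" by (simp add: sum_nonneg)
      ultimately show ?thesis by linarith
    next
      case False
      have "real (walk_max (\<lambda>x. f x = q) (rev xs)) \<le> ?S xs"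
        using q(1) False V(1) by (intro member_le_sum) auto
      \<comment> \<open>The drift is nonnegative, so it may be added to the bound for another
        part.\<close>
      moreover have "?d \<ge> 0" using maj by linarith
      ultimately show ?thesis using q(2) by linarith
    qed
  qed
  then have "(\<Sum>xs\<in>?\<Pi>. real (final_vote f xs)) \<le>
      (\<Sum>xs\<in>?\<Pi>. ?d + real (walk_max (\<lambda>x. f x \<noteq> p) xs) + ?S xs)" by (rule sum_mono)
  also have "\<dots> = fact (card V) * ?d + (\<Sum>xs\<in>?\<Pi>. real (walk_max (\<lambda>x. f x \<noteq> p) xs)) + (\<Sum>xs\<in>?\<Pi>. ?S xs)"
    using V(1) by (simp add: sum.distrib)
  also have "(\<Sum>xs\<in>?\<Pi>. ?S xs) =
      (\<Sum>q\<in>f ` V - {p}. \<Sum>xs\<in>?\<Pi>. real (walk_max (\<lambda>x. f x = q) (rev xs)))"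
    by (rule sum.swap)
  finally have "(\<Sum>xs\<in>?\<Pi>. real (final_vote f xs)) / fact (card V) \<le>
      ?d + mean_walk_max V (\<lambda>x. f x \<noteq> p) + (\<Sum>q\<in>f ` V - {p}. mean_walk_max V (\<lambda>x. f x = q))"
    unfolding mean_walk_max_rev[of V "\<lambda>x. f x = _"] mean_walk_max_def[of V "\<lambda>x. f x \<noteq> p"]
    by (simp add: field_simps flip: sum_divide_distrib)
  then show ?thesis unfolding rc_avg_multipartite[OF V] by linarith
qed

section \<open>Complete multipartite graphs with given part sizes\<close>

lemma kp_verts_eq_Sigma: "kp_verts k s = Sigma {..<k} (\<lambda>i. {..<s i})"
  by (auto simp: kp_verts_def)

lemma card_kp_part:
  assumes "q < k"
  shows "card {x\<in>kp_verts k s. fst x = q} = s q"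
proof -
  have "{x\<in>kp_verts k s. fst x = q} = {q} \<times> {..<s q}" using assms by (auto simp: kp_verts_def)
  then show ?thesis by (simp add: card_cartesian_product)
qed

theorem theorem3:
  fixes k :: nat and c :: "nat \<Rightarrow> real"
  assumes "k \<ge> 3"
    and "\<forall>i j. i \<le> j \<and> j < k \<longrightarrow> c j \<le> c i"
    and "\<forall>i<k. c i > 0"
    and "(\<Sum>i<k. c i) = 1"
  shows "(c 0 < 1/2 \<longrightarrow>
            (\<exists>C N0. \<forall>n. n \<ge> N0 \<and> (\<forall>i<k. c i * real n \<in> \<int>) \<longrightarrow>
                \<bar>rc_avg_kp k c n - real n\<bar> \<le> C))
       \<and> (c 0 = 1/2 \<longrightarrow>
            (\<exists>C N0. \<forall>n. n \<ge> N0 \<and> (\<forall>i<k. c i * real n \<in> \<int>) \<longrightarrow>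
                \<bar>rc_avg_kp k c n - real n\<bar> \<le> C * sqrt (real n)))
       \<and> (c 0 > 1/2 \<longrightarrow>
            (\<exists>C N0. \<forall>n. n \<ge> N0 \<and> (\<forall>i<k. c i * real n \<in> \<int>) \<longrightarrow>
                \<bar>rc_avg_kp k c n - 2 * c 0 * real n\<bar> \<le> C))"
proof -
  note k = assms(1) and cpos = assms(3) and csum = assms(4)
  \<comment> \<open>Bounds the contribution of all parts except the first, independently of
    \<open>n\<close>.\<close>
  define K where "K = (\<Sum>q\<in>{..<k} - {0}. 1 / (1 - 2 * c q))"
  \<comment> \<open>A third part \<open>r\<close> of positive share forces
    \<open>c 0 + c q < 1\<close>, and \<open>c q\<close> is at most \<open>c 0\<close>.\<close>
  have c_small: "c q < 1/2" if q: "q < k" "q \<noteq> 0" for q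
  proof -
    have "\<exists>r<k. r \<noteq> 0 \<and> r \<noteq> q" using k by (intro exI[of _ "if q = 1 then 2 else 1"]) auto
    then obtain r where r: "r < k" "r \<noteq> 0" "r \<noteq> q" by blast
    have "sum c {0, q, r} \<le> sum c {..<k}"
      using q r k cpos by (intro sum_mono2) (auto intro: less_imp_le)
    then have "c 0 + c q + c r \<le> 1" using q r csum by simp
    moreover have "c q \<le> c 0" "c r > 0" using assms(2,3) q r by auto
    ultimately show ?thesis by linarith
  qed
  have K0: "K \<ge> 0" unfolding K_def by (intro sum_nonneg) (use c_small in fastforce)

  let ?V = "\<lambda>n. kp_verts k (part_sizes c n)"
  let ?W = "\<lambda>n. mean_walk_max (?V n)"
  have kp_adj: "kp_adj = (\<lambda>x y. fst x \<noteq> fst y)" by (auto simp: kp_adj_def fun_eq_iff)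
  \<comment> \<open>Integrality makes the floor in \<open>part_sizes\<close> exact;
    \<open>n \<ge> 1\<close> makes every part nonempty, so each vertex has a neighbour.\<close>
  have facts: "finite (?V n) \<and> ?V n \<noteq> {} \<and> (\<forall>v\<in>?V n. \<exists>u\<in>?V n. fst u \<noteq> fst v) \<and>
      fst ` ?V n = {..<k} \<and> card (?V n) = n \<and>
      (\<forall>q<k. real (card {x\<in>?V n. fst x = q}) = c q * real n)"
    if n: "n \<ge> 1" "\<forall>i<k. c i * real n \<in> \<int>" for n
  proof -
    have size: "real (part_sizes c n i) = c i * real n" if "i < k" for i
    proof -
      have "c i * real n \<ge> 0" using cpos that by (simp add: less_imp_le)
      moreover have "real_of_int \<lfloor>c i * real n\<rfloor> = c i * real n" using n(2) that by (auto elim: Ints_cases)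
      ultimately show ?thesis by (simp add: part_sizes_def)
    qed
    have pos: "part_sizes c n i > 0" if "i < k" for i
    proof -
      have "real (part_sizes c n i) > 0" using size[OF that] cpos that n(1) by simp
      then show ?thesis by simp
    qed
    have "real (card (?V n)) = (\<Sum>i<k. c i) * real n"
      using size by (simp add: kp_verts_eq_Sigma sum_distrib_right)
    then have "card (?V n) = n" using csum by simp
    moreover have im: "fst ` ?V n = {..<k}" using pos by (force simp: kp_verts_eq_Sigma)
    moreover have "\<exists>u\<in>?V n. fst u \<noteq> fst v" for v
    proof -
      define r where "r = (if fst v = 0 then 1 else 0 :: nat)"
      have "r \<in> fst ` ?V n" unfolding im r_def using k by auto
      moreover have "r \<noteq> fst v" by (simp add: r_def)
      ultimately show ?thesis by fastforce
    qed
    moreover have "?V n \<noteq> {}"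
    proof -
      have "0 \<in> fst ` ?V n" unfolding im using k by simp
      then show ?thesis by blast
    qed
    moreover have "finite (?V n)" by (simp add: kp_verts_eq_Sigma)
    ultimately show ?thesis using size by (auto simp: card_kp_part)
  qed
  have lower: "rc_avg_kp k c n \<ge> real n" "rc_avg_kp k c n \<ge> 2 * c 0 * real n - 1"
    if n: "n \<ge> 1" "\<forall>i<k. c i * real n \<in> \<int>" for n
    using rc_avg_ge(1)[of "?V n" fst] rc_avg_ge(2)[of "?V n" fst 0] facts[OF n] k by (auto simp: rc_avg_kp_def kp_adj)
  have small: "(\<Sum>q\<in>{..<k} - {0}. ?W n (\<lambda>x. fst x = q)) \<le> K"
    if n: "n \<ge> 1" "\<forall>i<k. c i * real n \<in> \<int>" for n
    unfolding K_def using facts[OF n] c_small by (intro sum_mono mean_walk_max_le) auto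
  have upper: "rc_avg_kp k c n \<le> real n + ?W n (\<lambda>x. fst x = 0) + K"
    if n: "n \<ge> 1" "\<forall>i<k. c i * real n \<in> \<int>" for n
  proof -
    have "rc_avg_kp k c n \<le> real n + (\<Sum>q<k. ?W n (\<lambda>x. fst x = q))"
      using rc_avg_le[of "?V n" fst] facts[OF n] by (simp add: rc_avg_kp_def kp_adj)
    also have "(\<Sum>q<k. ?W n (\<lambda>x. fst x = q)) = ?W n (\<lambda>x. fst x = 0) + (\<Sum>q\<in>{..<k} - {0}. ?W n (\<lambda>x. fst x = q))"
      using k by (intro sum.remove) auto
    finally show ?thesis using small[OF n] by linarith
  qed

  have "\<bar>rc_avg_kp k c n - real n\<bar> \<le> 1 / (1 - 2 * c 0) + K"
    if "c 0 < 1/2" and n: "n \<ge> 1" "\<forall>i<k. c i * real n \<in> \<int>" for n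
  proof -
    have "?W n (\<lambda>x. fst x = 0) \<le> 1 / (1 - 2 * c 0)"
      using facts[OF n] that(1) k by (intro mean_walk_max_le) auto
    then show ?thesis using upper[OF n] lower(1)[OF n] by linarith
  qed
  moreover have "\<bar>rc_avg_kp k c n - real n\<bar> \<le> (2 + K) * sqrt (real n)"
    if "c 0 = 1/2" and n: "n \<ge> 1" "\<forall>i<k. c i * real n \<in> \<int>" for n
  proof -
    have "real (2 * card {x\<in>?V n. fst x = 0}) = real (card (?V n))"
      using facts[OF n] that(1) k by auto
    then have "2 * card {x\<in>?V n. fst x = 0} = card (?V n)" by (rule of_nat_eq_iff[THEN iffD1])
    then have "?W n (\<lambda>x. fst x = 0) \<le> 2 * sqrt (real n)"
      using mean_walk_max_balanced_le[of "?V n"] facts[OF n] by simp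
    moreover have "K * 1 \<le> K * sqrt (real n)" using K0 n(1) by (intro mult_left_mono) auto
    ultimately show ?thesis using upper[OF n] lower(1)[OF n] by (simp add: algebra_simps)
  qed
  \<comment> \<open>The complement of part 0 has share \<open>1 - c 0 < 1/2\<close>, which yields
    the first summand; the final 1 comes from the lower bound.\<close>
  moreover have "\<bar>rc_avg_kp k c n - 2 * c 0 * real n\<bar> \<le> 1 / (1 - 2 * (1 - c 0)) + K + 1"
    if "c 0 > 1/2" and n: "n \<ge> 1" "\<forall>i<k. c i * real n \<in> \<int>" for n
  proof -
    note F = facts[OF n]
    have c0: "real (card {x\<in>?V n. fst x = 0}) = c 0 * real n" using F k by auto
    have "card (?V n) = card {x\<in>?V n. fst x = 0} + card {x\<in>?V n. fst x \<noteq> 0}"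
      using F by (intro card_split) auto
    then have "real (card {x\<in>?V n. fst x \<noteq> 0}) = real n - real (card {x\<in>?V n. fst x = 0})"
      using F by linarith
    then have "?W n (\<lambda>x. fst x \<noteq> 0) \<le> 1 / (1 - 2 * (1 - c 0))"
      using F that(1) c0 by (intro mean_walk_max_le) (auto simp: algebra_simps)
    moreover have "real (card (?V n)) \<le> real (2 * card {x\<in>?V n. fst x = 0})"
      using F c0 that(1) mult_right_mono[of "1/2" "c 0" "real n"] by simp
    then have "card (?V n) \<le> 2 * card {x\<in>?V n. fst x = 0}" by (rule of_nat_le_iff[THEN iffD1])
    then have "rc_avg_kp k c n \<le> 2 * c 0 * real n + ?W n (\<lambda>x. fst x \<noteq> 0)
        + (\<Sum>q\<in>{..<k} - {0}. ?W n (\<lambda>x. fst x = q))"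
      using rc_avg_le_majority[of "?V n" fst 0] F c0 by (simp add: rc_avg_kp_def kp_adj)
    moreover have "1 / (1 - 2 * (1 - c 0)) \<ge> 0" using that(1) by simp
    ultimately show ?thesis
      using small[OF n] lower(2)[OF n] K0 by (intro abs_leI) linarith+
  qed
  ultimately show ?thesis by blast
qed

end
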